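(* For every infinite-dimensional Banach space $X$ and every $\alpha\in(0,1]$, $$\lambda_{\alpha}(X,c_0)=\kappa(X)^{\alpha}.$$
   Context: Banach spaces are real; $c_0$ is the real Banach space of null sequences with the supremum norm. $B(X)$ denotes the unit ball of $X$. Kottman constant: for an infinite-dimensional Banach space $X$, $\kappa(X):=\sup_{(x_n)\subset B(X)}\operatorname{sep}(x_n)$, the supremum being over all sequences $(x_n)_{n\in\mathbb N}$ in $B(X)$, where $\operatorname{sep}(x_n)=\inf_{n\neq m}\|x_n-x_m\|$. Hölder maps: for metric spaces $(X,d)$, $(Y,\rho)$ and $\alpha\in(0,1]$, a map $f:X\to Y$ is $\alpha$-Hölder if $\operatorname{Lip}_{\alpha}(f)=\sup\{\rho(f(x),f(y))/d(x,y)^{\alpha}: x\neq y\}<\infty$. Extension constant: $\lambda_{\alpha}(X,Y)$ is the infimum of all $\lambda>0$ such that for every subset $M$ of $X$, every $\alpha$-Hölder map $f:M\to Y$ admits an extension $F:X\to Y$ with $\operatorname{Lip}_{\alpha}(F)\leq\lambda\operatorname{Lip}_{\alpha}(f)$ (with value $\infty$ if no such $\lambda$ exists). *)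

theory Defs
  imports "HOL-Analysis.Analysis"
begin

typedef c0 = "{x :: nat \<Rightarrow> real. x \<longlonglongrightarrow> 0}"
  morphisms c0_nth Abs_c0
  by (intro exI[of _ "\<lambda>_. 0"]) simp

setup_lifting type_definition_c0

lemma c0_nth_tendsto: "c0_nth x \<longlonglongrightarrow> 0"
  using c0_nth[of x] by simp

lemma c0_eqI: "(\<And>n. c0_nth x n = c0_nth y n) \<Longrightarrow> x = y"
  by (auto simp flip: c0_nth_inject)

lemma c0_bdd_above: "bdd_above (range (\<lambda>n. \<bar>c0_nth x n\<bar>))"
proof -
  have "Bseq (c0_nth x)"
    using c0_nth_tendsto by (intro convergent_imp_Bseq convergentI)
  then obtain K where "\<And>n. \<bar>c0_nth x n\<bar> \<le> K"
    by (auto simp: Bseq_def)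
  then show ?thesis
    by (intro bdd_aboveI[of _ K]) auto
qed

instantiation c0 :: real_vector
begin

lift_definition zero_c0 :: c0 is "\<lambda>_. 0"
  by simp

lift_definition plus_c0 :: "c0 \<Rightarrow> c0 \<Rightarrow> c0" is "\<lambda>x y n. x n + y n"
  using tendsto_add by fastforce

lift_definition minus_c0 :: "c0 \<Rightarrow> c0 \<Rightarrow> c0" is "\<lambda>x y n. x n - y n"
  using tendsto_diff by fastforce

lift_definition uminus_c0 :: "c0 \<Rightarrow> c0" is "\<lambda>x n. - x n"
  using tendsto_minus by fastforce

lift_definition scaleR_c0 :: "real \<Rightarrow> c0 \<Rightarrow> c0" is "\<lambda>c x n. c * x n"
  by (rule tendsto_mult_right_zero)

instance
  by standard (transfer; simp add: algebra_simps)+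

end

instantiation c0 :: real_normed_vector
begin

definition norm_c0 :: "c0 \<Rightarrow> real"
  where "norm_c0 x = (SUP n. \<bar>c0_nth x n\<bar>)"

definition sgn_c0 :: "c0 \<Rightarrow> c0"
  where "sgn_c0 x = x /\<^sub>R norm x"

definition dist_c0 :: "c0 \<Rightarrow> c0 \<Rightarrow> real"
  where "dist_c0 x y = norm (x - y)"

definition uniformity_c0 :: "(c0 \<times> c0) filter"
  where "uniformity_c0 = (INF e\<in>{0<..}. principal {(x, y). dist x y < e})"

definition open_c0 :: "c0 set \<Rightarrow> bool"
  where "open_c0 U = (\<forall>x\<in>U. \<forall>\<^sub>F (x', y) in uniformity. x' = x \<longrightarrow> y \<in> U)"

lemma c0_nth_le_norm: "\<bar>c0_nth x n\<bar> \<le> norm x"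
  unfolding norm_c0_def by (rule cSUP_upper[OF _ c0_bdd_above]) simp

lemma c0_norm_le: "(\<And>n. \<bar>c0_nth x n\<bar> \<le> K) \<Longrightarrow> norm x \<le> K"
  unfolding norm_c0_def by (rule cSUP_least) auto

instance
proof
  fix x y :: c0 and a :: real
  show "norm x = 0 \<longleftrightarrow> x = 0"
  proof
    assume "norm x = 0"
    then have "c0_nth x n = 0" for n
      using c0_nth_le_norm[of x n] by simp
    then show "x = 0"
      by (intro c0_eqI) (simp add: zero_c0.rep_eq)
  qed (simp add: norm_c0_def zero_c0.rep_eq)
  show "norm (x + y) \<le> norm x + norm y"
  proof (rule c0_norm_le)
    fix n
    show "\<bar>c0_nth (x + y) n\<bar> \<le> norm x + norm y"
      using c0_nth_le_norm[of x n] c0_nth_le_norm[of y n]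
      by (simp add: plus_c0.rep_eq)
  qed
  have scale_le: "norm (b *\<^sub>R z) \<le> \<bar>b\<bar> * norm z" for b and z :: c0
    by (rule c0_norm_le)
       (simp add: scaleR_c0.rep_eq abs_mult mult_left_mono c0_nth_le_norm)
  show "norm (a *\<^sub>R x) = \<bar>a\<bar> * norm x"
  proof (cases "a = 0")
    case True
    then show ?thesis
      by (simp add: norm_c0_def zero_c0.rep_eq)
  next
    case False
    then have "norm x \<le> \<bar>inverse a\<bar> * norm (a *\<^sub>R x)"
      using scale_le[of "inverse a" "a *\<^sub>R x"] by simp
    with False have "\<bar>a\<bar> * norm x \<le> norm (a *\<^sub>R x)"
      by (simp add: field_simps)
    with scale_le[of a x] show ?thesis
      by simp
  qed
qed (rule sgn_c0_def dist_c0_def uniformity_c0_def open_c0_def)+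

end

instance c0 :: banach
proof
  fix X :: "nat \<Rightarrow> c0"
  assume X: "Cauchy X"
  have nth_dist: "\<bar>c0_nth x n - c0_nth y n\<bar> \<le> dist x y" for x y n
    using c0_nth_le_norm[of "x - y" n] by (simp add: dist_norm minus_c0.rep_eq)
  have "Cauchy (\<lambda>k. c0_nth (X k) n)" for n
    unfolding Cauchy_def
  proof (intro allI impI)
    fix e :: real
    assume "e > 0"
    then obtain N where "\<forall>i\<ge>N. \<forall>j\<ge>N. dist (X i) (X j) < e"
      using X by (meson Cauchy_def)
    then show "\<exists>N. \<forall>i\<ge>N. \<forall>j\<ge>N. dist (c0_nth (X i) n) (c0_nth (X j) n) < e"
      unfolding dist_real_def using nth_dist le_less_trans by blast
  qed
  then have "\<exists>l. (\<lambda>k. c0_nth (X k) n) \<longlonglongrightarrow> l" for n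
    by (simp add: Cauchy_convergent_iff convergent_def)
  then obtain y where y: "\<And>n. (\<lambda>k. c0_nth (X k) n) \<longlonglongrightarrow> y n"
    by metis
  have unif: "\<exists>N. \<forall>k\<ge>N. \<forall>n. \<bar>c0_nth (X k) n - y n\<bar> \<le> e" if "e > 0" for e
  proof -
    obtain N where N: "\<And>i j. i \<ge> N \<Longrightarrow> j \<ge> N \<Longrightarrow> dist (X i) (X j) < e"
      using X \<open>e > 0\<close> by (meson Cauchy_def)
    have "\<bar>c0_nth (X k) n - y n\<bar> \<le> e" if "k \<ge> N" for k n
    proof (rule tendsto_upperbound)
      show "(\<lambda>j. \<bar>c0_nth (X k) n - c0_nth (X j) n\<bar>) \<longlonglongrightarrow> \<bar>c0_nth (X k) n - y n\<bar>"
        by (intro tendsto_intros y)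
      show "\<forall>\<^sub>F j in sequentially. \<bar>c0_nth (X k) n - c0_nth (X j) n\<bar> \<le> e"
        using eventually_ge_at_top[of N]
      proof eventually_elim
        case (elim j)
        then show ?case
          using nth_dist[of "X k" n "X j"] N[OF that elim] by linarith
      qed
    qed simp
    then show ?thesis
      by blast
  qed
  have "y \<longlonglongrightarrow> 0"
  proof (rule LIMSEQ_I)
    fix e :: real
    assume "e > 0"
    then obtain k where k: "\<And>n. \<bar>c0_nth (X k) n - y n\<bar> \<le> e / 2"
      using unif[of "e / 2"] by auto
    obtain N where N: "\<And>n. n \<ge> N \<Longrightarrow> \<bar>c0_nth (X k) n\<bar> < e / 2"
      using LIMSEQ_D[OF c0_nth_tendsto[of "X k"], of "e / 2"] \<open>e > 0\<close> by auto
    have "norm (y n - 0) < e" if "n \<ge> N" for n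
      using k[of n] N[OF that] unfolding real_norm_def by linarith
    then show "\<exists>N. \<forall>n\<ge>N. norm (y n - 0) < e"
      by blast
  qed
  then have nth_y: "c0_nth (Abs_c0 y) = y"
    by (simp add: Abs_c0_inverse)
  have "X \<longlonglongrightarrow> Abs_c0 y"
  proof (rule LIMSEQ_I)
    fix e :: real
    assume "e > 0"
    then obtain N where N: "\<And>k n. k \<ge> N \<Longrightarrow> \<bar>c0_nth (X k) n - y n\<bar> \<le> e / 2"
      using unif[of "e / 2"] by auto
    have "norm (X k - Abs_c0 y) < e" if "k \<ge> N" for k
    proof -
      have "norm (X k - Abs_c0 y) \<le> e / 2"
        by (rule c0_norm_le) (unfold minus_c0.rep_eq nth_y, rule N[OF that])
      with \<open>e > 0\<close> show ?thesis
        by simp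
    qed
    then show "\<exists>N. \<forall>k\<ge>N. norm (X k - Abs_c0 y) < e"
      by blast
  qed
  then show "convergent X"
    by (rule convergentI)
qed

definition infinite_dimensional :: "'a::real_vector itself \<Rightarrow> bool"
  where "infinite_dimensional _ \<longleftrightarrow> \<not> (\<exists>B :: 'a set. finite B \<and> span B = UNIV)"

definition sep :: "(nat \<Rightarrow> 'a::real_normed_vector) \<Rightarrow> real"
  where "sep x = (INF (n, m) \<in> {(n, m). n \<noteq> m}. norm (x n - x m))"

lemma sep_nonneg: "0 \<le> sep x"
  unfolding sep_def by (rule cINF_greatest) (auto intro: exI[of _ 0] exI[of _ "Suc 0"])

lemma sep_le_2:
  assumes "range x \<subseteq> cball 0 1"
  shows "sep x \<le> 2"
proof -
  have "sep x \<le> norm (x 0 - x 1)"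
    unfolding sep_def
    by (rule cINF_lower2[where x = "(0, 1)"]) (auto intro!: bdd_belowI[of _ 0])
  also have "\<dots> \<le> norm (x 0) + norm (x 1)"
    by (rule norm_triangle_ineq4)
  also have "\<dots> \<le> 1 + 1"
    using assms by (intro add_mono) (auto simp: image_subset_iff)
  finally show ?thesis
    by simp
qed

text \<open>By the two bounds above, this is the supremum of a nonempty bounded set of reals.\<close>

definition kottman :: "'a::real_normed_vector itself \<Rightarrow> real"
  where "kottman _ = (SUP x \<in> {x :: nat \<Rightarrow> 'a. range x \<subseteq> cball 0 1}. sep x)"

text \<open>A map on a subset \<open>M\<close> is represented by a total function of which only the values on
  \<open>M\<close> matter. The constant takes the value \<open>\<infinity>\<close> if the quotients are unbounded, and \<open>0\<close> if
  \<open>M\<close> has at most one point.\<close>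

definition hoelder_const ::
    "real \<Rightarrow> 'a::metric_space set \<Rightarrow> ('a \<Rightarrow> 'b::metric_space) \<Rightarrow> ennreal"
  where "hoelder_const \<alpha> M f =
    (SUP (x, y) \<in> {(x, y). x \<in> M \<and> y \<in> M \<and> x \<noteq> y}.
       ennreal (dist (f x) (f y) / dist x y powr \<alpha>))"

definition hoelder_on ::
    "real \<Rightarrow> 'a::metric_space set \<Rightarrow> ('a \<Rightarrow> 'b::metric_space) \<Rightarrow> bool"
  where "hoelder_on \<alpha> M f \<longleftrightarrow> hoelder_const \<alpha> M f < \<infinity>"

definition extension_const ::
    "real \<Rightarrow> 'a::metric_space itself \<Rightarrow> 'b::metric_space itself \<Rightarrow> ennreal"
  where "extension_const \<alpha> _ _ =
    Inf {ennreal l | l :: real. 0 < l \<and>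
      (\<forall>(M :: 'a set) (f :: 'a \<Rightarrow> 'b). hoelder_on \<alpha> M f \<longrightarrow>
        (\<exists>F :: 'a \<Rightarrow> 'b. (\<forall>x\<in>M. F x = f x) \<and>
          hoelder_const \<alpha> UNIV F \<le> ennreal l * hoelder_const \<alpha> M f))}"

end

theory Submission
  imports Defs
begin

text \<open>
  Both inequalities come from looking at the values that an extension can take at a single point.

  \<^bold>\<open>Lower bound.\<close> If \<open>x\<close> is a separated sequence in the unit ball, the map sending \<open>x n\<close> to the
  \<open>n\<close>-th unit vector of \<open>c0\<close> has Hoelder constant at most \<open>sep x powr -\<alpha>\<close>. The value of an
  extension at \<open>0\<close> is a null sequence, so its distance to the \<open>n\<close>-th unit vector is at least
  nearly \<open>1\<close> for large \<open>n\<close>, although \<open>x n\<close> has distance at most \<open>1\<close> from \<open>0\<close>. Hence the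
  extension has constant at least \<open>1\<close>, and the constants have grown by the factor
  \<open>sep x powr \<alpha>\<close> at least (\<open>sep_powr_le_extension_bound\<close>).

  \<^bold>\<open>Upper bound.\<close> Let \<open>f\<close> be a map on \<open>M\<close> with constant \<open>k\<close>, and let \<open>L / k\<close> exceed
  \<open>kottman powr \<alpha>\<close>. Since \<open>dist powr \<alpha>\<close> is again a metric, each coordinate of \<open>f\<close> has McShane
  extensions with constant \<open>L\<close>. At each point choose between the least and the
  greatest of them the value closest to \<open>0\<close>. The only question is whether these values tend
  to \<open>0\<close> at a given point \<open>x\<close>. If they do not, then, up to replacing \<open>f\<close> by its negative, there
  are infinitely many coordinates \<open>n\<close> with points \<open>m n \<in> M\<close> where the \<open>n\<close>-th coordinate of \<open>f\<close>
  exceeds \<open>\<epsilon> + L * dist x (m n) powr \<alpha>\<close>. As \<open>f (m i)\<close> is a null sequence, along a subsequence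
  the later coordinates of the earlier \<open>f (m i)\<close> are negligible, so that the Hoelder condition makes
  \<open>m j\<close> far from \<open>m i\<close> compared with its distance to \<open>x\<close>: for \<open>y j = m j - x\<close> and \<open>i < j\<close>,
  the quantity \<open>k * norm (y j - y i) powr \<alpha>\<close> is at least
  \<open>L * norm (y j) powr \<alpha> + \<epsilon> / 2\<close> (\<open>eventually_mcshane_bound\<close>). Because \<open>k < L\<close>, the sequence \<open>y\<close>
  is bounded; after thinning it out until the norms nearly agree and rescaling it into the unit ball, it
  shows that \<open>kottman powr \<alpha>\<close> is at least \<open>L / k\<close> (\<open>le_kottman_powr\<close>), a contradiction.

  That \<open>k < L\<close> whenever \<open>L / k\<close> exceeds \<open>kottman powr \<alpha>\<close> is where the infinite dimension enters: by
  Riesz's lemma the Kottman constant is then at least \<open>1\<close> (\<open>one_le_kottman\<close>).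
\<close>

section \<open>Powers of distances and Hoelder constants\<close>

lemma powr_add_le_add_powr:
  fixes a b \<alpha> :: real
  assumes "0 \<le> a" "0 \<le> b" "\<alpha> \<le> 1"
  shows "(a + b) powr \<alpha> \<le> a powr \<alpha> + b powr \<alpha>"
proof (cases "a = 0 \<or> b = 0")
  case False
  with assms have pos: "0 < a" "0 < b"
    by auto
  have "(a + b) powr \<alpha> = (a + b) * (a + b) powr (\<alpha> - 1)"
    using pos by (simp add: powr_diff)
  also have "\<dots> = a * (a + b) powr (\<alpha> - 1) + b * (a + b) powr (\<alpha> - 1)"
    by (rule distrib_right)
  also have "\<dots> \<le> a * a powr (\<alpha> - 1) + b * b powr (\<alpha> - 1)"
    using pos assms by (intro add_mono mult_left_mono powr_mono2') auto
  also have "\<dots> = a powr \<alpha> + b powr \<alpha>"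
    using pos by (simp add: powr_diff)
  finally show ?thesis .
qed auto

lemma dist_powr_triangle:
  fixes x y z :: "'a::metric_space"
  assumes "0 \<le> \<alpha>" "\<alpha> \<le> 1"
  shows "dist x z powr \<alpha> \<le> dist x y powr \<alpha> + dist y z powr \<alpha>"
proof -
  have "dist x z powr \<alpha> \<le> (dist x y + dist y z) powr \<alpha>"
    using assms by (intro powr_mono2 dist_triangle) auto
  also have "\<dots> \<le> dist x y powr \<alpha> + dist y z powr \<alpha>"
    using assms by (intro powr_add_le_add_powr) auto
  finally show ?thesis .
qed

lemma hoelder_const_le_iff:
  assumes "0 \<le> K"
  shows "hoelder_const \<alpha> M f \<le> ennreal K \<longleftrightarrow>
    (\<forall>x\<in>M. \<forall>y\<in>M. dist (f x) (f y) \<le> K * dist x y powr \<alpha>)"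
proof -
  have "ennreal (dist (f x) (f y) / dist x y powr \<alpha>) \<le> ennreal K \<longleftrightarrow>
      dist (f x) (f y) \<le> K * dist x y powr \<alpha>" if "x \<noteq> y" for x y
    using that assms by (simp add: ennreal_le_iff pos_divide_le_eq)
  moreover have "dist (f x) (f y) \<le> K * dist x y powr \<alpha>" if "x = y" for x y
    using that by simp
  ultimately show ?thesis
    unfolding hoelder_const_def SUP_le_iff by (force simp: split_beta)
qed

section \<open>The Kottman constant is at least one\<close>

text \<open>For \<open>x\<close> outside the closed subspace \<open>span A\<close>, the coefficient of \<open>x\<close> in an element of
  \<open>span (insert x A)\<close> is bounded by the norm of that element divided by the distance from \<open>x\<close> to
  \<open>span A\<close>. So along a convergent sequence the coefficients converge, and with them the components
  in \<open>span A\<close>.\<close>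

lemma closed_span_finite:
  fixes A :: "'a::banach set"
  assumes "finite A"
  shows "closed (span A)"
  using assms
proof induction
  case (insert x A)
  show ?case
  proof (cases "x \<in> span A")
    case True
    then show ?thesis
      using insert.IH by (simp add: span_redundant)
  next
    case False
    define d where "d = infdist x (span A)"
    have ne: "span A \<noteq> {}"
      using span_zero by blast
    have "0 < d"
      using False insert.IH ne unfolding d_def
      by (metis in_closed_iff_infdist_zero infdist_nonneg less_eq_real_def)
    have coeff_le: "\<bar>c\<bar> * d \<le> norm (c *\<^sub>R x + y)" if "y \<in> span A" for c y
    proof (cases "c = 0")
      case False
      have "d \<le> dist x (- (inverse c) *\<^sub>R y)"
        unfolding d_def using that by (intro infdist_le span_scale)
      then have "\<bar>c\<bar> * d \<le> \<bar>c\<bar> * norm (x + inverse c *\<^sub>R y)"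
        by (intro mult_left_mono) (simp_all add: dist_norm)
      also have "\<dots> = norm (c *\<^sub>R (x + inverse c *\<^sub>R y))"
        by simp
      also have "c *\<^sub>R (x + inverse c *\<^sub>R y) = c *\<^sub>R x + y"
        using False by (simp add: scaleR_add_right)
      finally show ?thesis .
    qed simp
    show ?thesis
      unfolding closed_sequential_limits
    proof (intro allI impI, elim conjE)
      fix u l
      assume u: "\<forall>n. u n \<in> span (insert x A)" and lim: "u \<longlonglongrightarrow> l"
      then obtain a where a: "\<And>n. u n - a n *\<^sub>R x \<in> span A"
        unfolding span_breakdown_eq by metis
      have a_dist: "\<bar>a m - a n\<bar> * d \<le> norm (u m - u n)" for m n
      proof -
        have "(u m - a m *\<^sub>R x) - (u n - a n *\<^sub>R x) \<in> span A"
          by (rule span_diff[OF a a])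
        from coeff_le[OF this, of "a m - a n"] show ?thesis
          by (simp add: algebra_simps)
      qed
      have "Cauchy a"
      proof (rule CauchyI)
        fix e :: real
        assume "0 < e"
        with \<open>0 < d\<close> obtain N where "\<forall>m\<ge>N. \<forall>n\<ge>N. norm (u m - u n) < e * d"
          using CauchyD[OF LIMSEQ_imp_Cauchy[OF lim], of "e * d"] by auto
        then have "\<forall>m\<ge>N. \<forall>n\<ge>N. \<bar>a m - a n\<bar> * d < e * d"
          using a_dist le_less_trans by blast
        with \<open>0 < d\<close> show "\<exists>N. \<forall>m\<ge>N. \<forall>n\<ge>N. norm (a m - a n) < e"
          by auto
      qed
      then obtain b where "a \<longlonglongrightarrow> b"
        by (auto simp: Cauchy_convergent_iff convergent_def)
      then have "(\<lambda>n. u n - a n *\<^sub>R x) \<longlonglongrightarrow> l - b *\<^sub>R x"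
        by (intro tendsto_intros lim)
      then have "l - b *\<^sub>R x \<in> span A"
        using a closed_sequentially[OF insert.IH] by meson
      then show "l \<in> span (insert x A)"
        unfolding span_breakdown_eq by blast
    qed
  qed
qed simp

text \<open>Riesz's lemma: the direction from a nearly closest point \<open>a\<close> of \<open>span A\<close> to a point \<open>x\<close>
  outside is nearly at distance \<open>1\<close> from all of \<open>span A\<close>.\<close>

lemma riesz_finite:
  fixes A :: "'a::banach set"
  assumes "infinite_dimensional TYPE('a)" "finite A" "s < 1"
  obtains z where "norm z = 1" "\<And>y. y \<in> A \<Longrightarrow> s \<le> norm (z - y)"
proof -
  obtain x where x: "x \<notin> span A"
    using assms(1,2) unfolding infinite_dimensional_def by blast
  \<comment> \<open>The distance \<open>d\<close> is divided by the factor below, which therefore has to be positive.\<close>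
  define t where "t = max s (1/2)"
  have t: "0 < t" "t < 1" "s \<le> t"
    using assms(3) by (auto simp: t_def)
  define d where "d = infdist x (span A)"
  have ne: "span A \<noteq> {}"
    using span_zero by blast
  have "0 < d"
    using x closed_span_finite[OF assms(2)] ne unfolding d_def
    by (metis in_closed_iff_infdist_zero infdist_nonneg less_eq_real_def)
  with t have "d < d / t"
    by (simp add: field_simps)
  then have "(INF y\<in>span A. dist x y) < d / t"
    using ne by (simp add: d_def infdist_def)
  then obtain a where a: "a \<in> span A" "dist x a < d / t"
    using cINF_less_iff[OF ne bdd_belowI2[of _ 0 "dist x"]] by auto
  define r where "r = norm (x - a)"
  have "x \<noteq> a"
    using x a by auto
  then have r: "0 < r" "t * r < d"
    using a t by (auto simp: r_def dist_norm field_simps)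
  show thesis
  proof (rule that[of "(x - a) /\<^sub>R r"])
    show "norm ((x - a) /\<^sub>R r) = 1"
      using r by (simp add: r_def)
    fix y
    assume "y \<in> A"
    then have "a + r *\<^sub>R y \<in> span A"
      using a by (intro span_add span_scale) (auto intro: span_base)
    then have "d \<le> dist x (a + r *\<^sub>R y)"
      unfolding d_def by (rule infdist_le)
    also have "\<dots> = norm (r *\<^sub>R ((x - a) /\<^sub>R r - y))"
      using r by (simp add: dist_norm scaleR_diff_right algebra_simps)
    also have "\<dots> = r * norm ((x - a) /\<^sub>R r - y)"
      using r by simp
    finally have "t * r < r * norm ((x - a) /\<^sub>R r - y)"
      using r by linarith
    then have "t < norm ((x - a) /\<^sub>R r - y)"
      using r by (simp add: mult.commute)
    with t show "s \<le> norm ((x - a) /\<^sub>R r - y)"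
      by linarith
  qed
qed

lemma sep_le:
  assumes "n \<noteq> m"
  shows "sep x \<le> norm (x n - x m)"
  unfolding sep_def using assms
  by (intro cINF_lower2[where x = "(n, m)"]) (auto intro!: bdd_belowI[of _ 0])

lemma sep_le_kottman:
  fixes x :: "nat \<Rightarrow> 'a::real_normed_vector"
  assumes "range x \<subseteq> cball 0 1"
  shows "sep x \<le> kottman TYPE('a)"
  unfolding kottman_def using assms
  by (intro cSUP_upper) (auto intro!: bdd_aboveI[of _ 2] sep_le_2)

lemma le_kottman:
  fixes x :: "nat \<Rightarrow> 'a::real_normed_vector"
  assumes "\<And>n. norm (x n) \<le> 1" "\<And>i j. i < j \<Longrightarrow> s \<le> norm (x j - x i)"
  shows "s \<le> kottman TYPE('a)"
proof -
  have "s \<le> norm (x n - x m)" if "n \<noteq> m" for n m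
    using that assms(2)[of n m] assms(2)[of m n]
    by (cases n m rule: linorder_cases) (auto simp: norm_minus_commute)
  then have "s \<le> sep x"
    unfolding sep_def by (intro cINF_greatest) (auto intro: exI[of _ 0] exI[of _ "Suc 0"])
  also have "\<dots> \<le> kottman TYPE('a)"
    using assms(1) by (intro sep_le_kottman) auto
  finally show ?thesis .
qed

lemma one_le_kottman:
  assumes "infinite_dimensional TYPE('a::banach)"
  shows "1 \<le> kottman TYPE('a)"
proof (rule dense_le)
  fix s :: real
  assume "s < 1"
  have "\<exists>x :: nat \<Rightarrow> 'a. \<forall>j. norm (x j) = 1 \<and> (\<forall>i<j. s \<le> norm (x j - x i))"
  proof (rule dependent_wellorder_choice)
    fix j and x :: "nat \<Rightarrow> 'a"
    obtain z :: 'a where "norm z = 1" "\<And>y. y \<in> x ` {..<j} \<Longrightarrow> s \<le> norm (z - y)"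
      using riesz_finite[OF assms _ \<open>s < 1\<close>, of "x ` {..<j}"] by auto
    then show "\<exists>z. norm z = 1 \<and> (\<forall>i<j. s \<le> norm (z - x i))"
      by (intro exI[of _ z]) auto
  qed auto
  then obtain x :: "nat \<Rightarrow> 'a"
    where "\<forall>j. norm (x j) = 1 \<and> (\<forall>i<j. s \<le> norm (x j - x i))" ..
  then show "s \<le> kottman TYPE('a)"
    by (intro le_kottman[of x]) auto
qed

text \<open>The sequence need not lie in the unit ball: what counts is the separation of \<open>y j\<close> from its
  predecessors relative to \<open>norm (y j)\<close>. Along a subsequence the numbers \<open>norm (y j) powr \<alpha>\<close>
  converge to some \<open>l\<close>, and dividing its tail by a radius slightly above \<open>l powr (1 / \<alpha>)\<close> gives a
  sequence in the unit ball. The additive gain \<open>\<delta>\<close> pays for the difference between the radius and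
  the norms, and it makes the argument work for \<open>l = 0\<close> too.\<close>

lemma le_kottman_powr:
  fixes y :: "nat \<Rightarrow> 'a::real_normed_vector"
  assumes "0 < \<alpha>" "0 < c" "0 < \<delta>"
    and bdd: "\<And>j. norm (y j) powr \<alpha> \<le> C"
    and sep: "\<And>i j. i < j \<Longrightarrow> c * norm (y j) powr \<alpha> + \<delta> \<le> norm (y j - y i) powr \<alpha>"
  shows "c \<le> kottman TYPE('a) powr \<alpha>"
proof -
  define t where "t = (\<lambda>j. norm (y j) powr \<alpha>)"
  have "bounded (range t)"
    using bdd by (intro boundedI[of _ C]) (auto simp: t_def)
  then obtain l r where r: "strict_mono (r :: nat \<Rightarrow> nat)" and lim: "(t \<circ> r) \<longlonglongrightarrow> l"
    using bounded_imp_convergent_subsequence by blast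
  have "0 \<le> l"
    using lim by (rule LIMSEQ_le_const) (auto simp: t_def)
  \<comment> \<open>Powers of norms within \<open>\<eta>\<close> of \<open>l\<close> lie at most \<open>2 * \<eta>\<close> below \<open>R powr \<alpha>\<close>, and
    \<open>c * (2 * \<eta>) = \<delta>\<close>.\<close>
  define \<eta> where "\<eta> = \<delta> / (2 * c)"
  have \<eta>: "0 < \<eta>" "c * \<eta> * 2 = \<delta>"
    using assms by (auto simp: \<eta>_def)
  obtain N where N: "\<And>j. j \<ge> N \<Longrightarrow> \<bar>t (r j) - l\<bar> < \<eta>"
    using LIMSEQ_D[OF lim \<eta>(1)] by auto
  define R where "R = (l + \<eta>) powr (1 / \<alpha>)"
  have "0 < R" and R: "R powr \<alpha> = l + \<eta>"
    using \<open>0 \<le> l\<close> \<eta> assms(1) by (auto simp: R_def powr_powr)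
  define z where "z = (\<lambda>j. y (r (j + N)) /\<^sub>R R)"
  have "c powr (1 / \<alpha>) \<le> kottman TYPE('a)"
  proof (rule le_kottman[of z])
    fix j
    have "norm (y (r (j + N))) powr \<alpha> \<le> R powr \<alpha>"
      using N[of "j + N"] by (auto simp: R t_def abs_less_iff)
    then have "norm (y (r (j + N))) \<le> R"
      using \<open>0 < R\<close> assms(1) powr_less_mono2[of \<alpha> R "norm (y (r (j + N)))"] by force
    then show "norm (z j) \<le> 1"
      using \<open>0 < R\<close> by (simp add: z_def field_simps)
  next
    fix i j :: nat
    assume "i < j"
    define w where "w = norm (y (r (j + N)) - y (r (i + N)))"
    have "c * (l - \<eta>) \<le> c * t (r (j + N))"
      using N[of "j + N"] assms(2) by (intro mult_left_mono) auto
    then have "c * R powr \<alpha> \<le> c * t (r (j + N)) + \<delta>"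
      unfolding R using \<eta> by (simp add: algebra_simps)
    also have "\<dots> \<le> w powr \<alpha>"
      unfolding t_def w_def using r \<open>i < j\<close> by (intro sep) (simp add: strict_mono_def)
    finally have "(c * R powr \<alpha>) powr (1 / \<alpha>) \<le> (w powr \<alpha>) powr (1 / \<alpha>)"
      using assms by (intro powr_mono2) auto
    then have "c powr (1 / \<alpha>) * R \<le> w"
      using assms \<open>0 < R\<close> by (simp add: powr_mult powr_powr w_def)
    moreover have "norm (z j - z i) = w / R"
      using \<open>0 < R\<close> by (simp add: z_def w_def divide_inverse flip: scaleR_diff_right)
    ultimately show "c powr (1 / \<alpha>) \<le> norm (z j - z i)"
      using \<open>0 < R\<close> by (simp add: pos_le_divide_eq)
  qed
  then have "(c powr (1 / \<alpha>)) powr \<alpha> \<le> kottman TYPE('a) powr \<alpha>"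
    using assms(1) by (intro powr_mono2) auto
  then show ?thesis
    using assms by (simp add: powr_powr)
qed

section \<open>Extending maps into the space of null sequences\<close>

text \<open>The least extension of \<open>g\<close> from \<open>M\<close> with Hoelder constant \<open>L\<close>; the greatest one is
  minus the least extension of \<open>-g\<close>.\<close>

definition mcshane :: "real \<Rightarrow> real \<Rightarrow> 'a::metric_space set \<Rightarrow> ('a \<Rightarrow> real) \<Rightarrow> 'a \<Rightarrow> real"
  where "mcshane \<alpha> L M g x = (SUP m\<in>M. g m - L * dist x m powr \<alpha>)"

context
  fixes \<alpha> L :: real and M :: "'a::metric_space set" and g :: "'a \<Rightarrow> real"
  assumes \<alpha>: "0 < \<alpha>" "\<alpha> \<le> 1" and L: "0 \<le> L" and M: "M \<noteq> {}"
    and g: "\<And>m m'. m \<in> M \<Longrightarrow> m' \<in> M \<Longrightarrow> g m - g m' \<le> L * dist m m' powr \<alpha>"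
begin

lemma mcshane_upper: "m \<in> M \<Longrightarrow> g m - L * dist x m powr \<alpha> \<le> mcshane \<alpha> L M g x"
  unfolding mcshane_def
proof (rule cSUP_upper)
  obtain p where "p \<in> M"
    using M by blast
  show "bdd_above ((\<lambda>m. g m - L * dist x m powr \<alpha>) ` M)"
  proof (rule bdd_aboveI2)
    fix m
    assume "m \<in> M"
    have "L * dist m p powr \<alpha> \<le> L * (dist m x powr \<alpha> + dist x p powr \<alpha>)"
      using \<alpha> L by (intro mult_left_mono dist_powr_triangle) auto
    with g[OF \<open>m \<in> M\<close> \<open>p \<in> M\<close>]
    show "g m - L * dist x m powr \<alpha> \<le> g p + L * dist x p powr \<alpha>"
      by (simp add: dist_commute algebra_simps)
  qed
qed

lemma mcshane_least:
  "(\<And>m. m \<in> M \<Longrightarrow> g m - L * dist x m powr \<alpha> \<le> K) \<Longrightarrow> mcshane \<alpha> L M g x \<le> K"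
  unfolding mcshane_def using M by (rule cSUP_least)

lemma mcshane_eq:
  assumes "x \<in> M"
  shows "mcshane \<alpha> L M g x = g x"
proof (rule antisym)
  show "mcshane \<alpha> L M g x \<le> g x"
    using g assms by (intro mcshane_least) (simp add: algebra_simps dist_commute)
  show "g x \<le> mcshane \<alpha> L M g x"
    using mcshane_upper[OF assms, of x] by simp
qed

lemma mcshane_hoelder:
  "\<bar>mcshane \<alpha> L M g x - mcshane \<alpha> L M g y\<bar> \<le> L * dist x y powr \<alpha>"
proof -
  have "mcshane \<alpha> L M g u \<le> mcshane \<alpha> L M g v + L * dist u v powr \<alpha>" for u v
  proof (rule mcshane_least)
    fix m
    assume "m \<in> M"
    have "L * dist v m powr \<alpha> \<le> L * (dist v u powr \<alpha> + dist u m powr \<alpha>)"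
      using \<alpha> L by (intro mult_left_mono dist_powr_triangle) auto
    with mcshane_upper[OF \<open>m \<in> M\<close>, of v]
    show "g m - L * dist u m powr \<alpha> \<le> mcshane \<alpha> L M g v + L * dist u v powr \<alpha>"
      by (simp add: algebra_simps dist_commute)
  qed
  from this[of x y] this[of y x] show ?thesis
    by (simp add: abs_le_iff dist_commute)
qed

end

text \<open>At no point \<open>x\<close> do the least extensions of infinitely many coordinates exceed \<open>\<epsilon>\<close>: the points
  of \<open>M\<close> that force them to do so would, seen from \<open>x\<close>, be too well separated for the Kottman
  constant.\<close>

lemma eventually_mcshane_bound:
  fixes f :: "'a::real_normed_vector \<Rightarrow> nat \<Rightarrow> real"
  assumes \<alpha>: "0 < \<alpha>" "\<alpha> \<le> 1" and "0 < k" "k < L"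
    and kottman: "kottman TYPE('a) powr \<alpha> < L / k"
    and null: "\<And>m. m \<in> M \<Longrightarrow> f m \<longlonglongrightarrow> 0"
    and hoelder: "\<And>m m' n. m \<in> M \<Longrightarrow> m' \<in> M \<Longrightarrow> f m n - f m' n \<le> k * dist m m' powr \<alpha>"
    and "0 < \<epsilon>"
  shows "\<forall>\<^sub>F n in sequentially. \<forall>m\<in>M. f m n - L * dist x m powr \<alpha> \<le> \<epsilon>"
proof (rule ccontr)
  define S where "S = {n. \<exists>m\<in>M. \<epsilon> < f m n - L * dist x m powr \<alpha>}"
  assume "\<not> ?thesis"
  then have S: "\<exists>n\<in>S. N \<le> n" for N
    unfolding S_def eventually_sequentially by (fastforce simp: not_le)
  have "\<forall>n\<in>S. \<exists>m. m \<in> M \<and> \<epsilon> < f m n - L * dist x m powr \<alpha>"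
    by (auto simp: S_def)
  then obtain p where p: "\<And>n. n \<in> S \<Longrightarrow> p n \<in> M"
      "\<And>n. n \<in> S \<Longrightarrow> \<epsilon> < f (p n) n - L * dist x (p n) powr \<alpha>"
    by metis
  have "\<exists>N. \<forall>n'\<ge>N. f (p n) n' < \<epsilon> / 2" if "n \<in> S" for n
    using order_tendstoD(2)[OF null[OF p(1)[OF that]], of "\<epsilon> / 2"] \<open>0 < \<epsilon>\<close>
    by (simp add: eventually_sequentially)
  then obtain N where N: "\<And>n n'. n \<in> S \<Longrightarrow> N n \<le> n' \<Longrightarrow> f (p n) n' < \<epsilon> / 2"
    by metis
  \<comment> \<open>Each chosen coordinate comes so late that the values of \<open>f\<close> at all earlier points are
    already below \<open>\<epsilon> / 2\<close> there.\<close>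
  have "\<exists>r :: nat \<Rightarrow> nat. \<forall>j. r j \<in> S \<and> (\<forall>i<j. N (r i) \<le> r j)"
  proof (rule dependent_wellorder_choice)
    fix j and r :: "nat \<Rightarrow> nat"
    show "\<exists>n. n \<in> S \<and> (\<forall>i<j. N (r i) \<le> n)"
    proof -
      obtain n where "n \<in> S" "Max (insert 0 ((\<lambda>i. N (r i)) ` {..<j})) \<le> n"
        using S by blast
      then show ?thesis
        by auto
    qed
  qed auto
  then obtain r :: "nat \<Rightarrow> nat" where r: "\<And>j. r j \<in> S" "\<And>i j. i < j \<Longrightarrow> N (r i) \<le> r j"
    by blast
  define y where "y = (\<lambda>j. p (r j) - x)"
  have sep: "L * norm (y j) powr \<alpha> + \<epsilon> / 2 \<le> k * norm (y j - y i) powr \<alpha>" if "i < j" for i j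
  proof -
    have "f (p (r j)) (r j) - f (p (r i)) (r j) \<le> k * dist (p (r j)) (p (r i)) powr \<alpha>"
      by (intro hoelder p r)
    moreover have "f (p (r i)) (r j) < \<epsilon> / 2"
      using that by (intro N r)
    moreover have "\<epsilon> < f (p (r j)) (r j) - L * dist x (p (r j)) powr \<alpha>"
      by (intro p r)
    ultimately show ?thesis
      by (simp add: y_def dist_norm norm_minus_commute)
  qed
  have "L / k \<le> kottman TYPE('a) powr \<alpha>"
  proof (rule le_kottman_powr[where y = y and \<delta> = "\<epsilon> / 2 / k"
        and C = "max 1 (k / (L - k)) * norm (y 0) powr \<alpha>"])
    show "L / k * norm (y j) powr \<alpha> + \<epsilon> / 2 / k \<le> norm (y j - y i) powr \<alpha>" if "i < j" for i j
      using sep[OF that] \<open>0 < k\<close> by (simp add: field_simps)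
    \<comment> \<open>Comparing with \<open>y 0\<close> bounds the sequence: as \<open>k < L\<close>, the triangle inequality lets the
      power of \<open>norm (y j)\<close> be absorbed.\<close>
    show "norm (y j) powr \<alpha> \<le> max 1 (k / (L - k)) * norm (y 0) powr \<alpha>" for j
    proof (cases "j = 0")
      case True
      have "1 * norm (y 0) powr \<alpha> \<le> max 1 (k / (L - k)) * norm (y 0) powr \<alpha>"
        by (intro mult_right_mono) auto
      with True show ?thesis
        by simp
    next
      case False
      have "k * norm (y j - y 0) powr \<alpha> \<le> k * (norm (y j) powr \<alpha> + norm (y 0) powr \<alpha>)"
        using dist_powr_triangle[of \<alpha> "y j" "y 0" 0] \<alpha> \<open>0 < k\<close>
        by (intro mult_left_mono) (auto simp: dist_norm)
      with sep[of 0 j] False \<open>0 < \<epsilon>\<close>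
      have "(L - k) * norm (y j) powr \<alpha> \<le> k * norm (y 0) powr \<alpha>"
        by (simp add: algebra_simps)
      then have "norm (y j) powr \<alpha> \<le> k / (L - k) * norm (y 0) powr \<alpha>"
        using \<open>k < L\<close> by (simp add: field_simps)
      also have "\<dots> \<le> max 1 (k / (L - k)) * norm (y 0) powr \<alpha>"
        by (intro mult_right_mono) auto
      finally show ?thesis .
    qed
  qed (use assms in auto)
  with kottman show False
    by simp
qed

lemma dist_c0_le_iff: "dist x y \<le> K \<longleftrightarrow> (\<forall>n. \<bar>c0_nth x n - c0_nth y n\<bar> \<le> K)"
proof
  show "dist x y \<le> K" if "\<forall>n. \<bar>c0_nth x n - c0_nth y n\<bar> \<le> K"
    using that unfolding dist_norm by (intro c0_norm_le) (simp add: minus_c0.rep_eq)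
  show "\<forall>n. \<bar>c0_nth x n - c0_nth y n\<bar> \<le> K" if "dist x y \<le> K"
    using that c0_nth_le_norm[of "x - y"] unfolding dist_norm minus_c0.rep_eq
    by (meson order_trans)
qed

lemma abs_clamp_diff_le:
  fixes a b c d K :: real
  assumes "\<bar>a - c\<bar> \<le> K" "\<bar>b - d\<bar> \<le> K"
  shows "\<bar>max a (min b 0) - max c (min d 0)\<bar> \<le> K"
  using assms by (auto simp: max_def min_def abs_le_iff)

text \<open>The \<open>n\<close>-th coordinate of the extension at \<open>x\<close> is the point closest to \<open>0\<close> of the interval
  between the least and the greatest McShane extension of the \<open>n\<close>-th coordinate of \<open>f\<close>. It
  is Hoelder with the same constant as the two ends, and it tends to \<open>0\<close> because the lower ends are
  eventually below every positive number and the upper ends eventually above every negative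
  one.\<close>

lemma c0_hoelder_extension:
  fixes f :: "'a::real_normed_vector \<Rightarrow> c0"
  assumes \<alpha>: "0 < \<alpha>" "\<alpha> \<le> 1" and k: "0 < k" "k < L"
    and kottman: "kottman TYPE('a) powr \<alpha> < L / k" and "M \<noteq> {}"
    and f: "\<And>x y. x \<in> M \<Longrightarrow> y \<in> M \<Longrightarrow> dist (f x) (f y) \<le> k * dist x y powr \<alpha>"
  obtains F where "\<And>x. x \<in> M \<Longrightarrow> F x = f x"
    "\<And>x y. dist (F x) (F y) \<le> L * dist x y powr \<alpha>"
proof -
  have "0 \<le> L"
    using k by simp
  have f_nth: "\<bar>c0_nth (f x) n - c0_nth (f y) n\<bar> \<le> k * dist x y powr \<alpha>"
    if "x \<in> M" "y \<in> M" for x y n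
    using f[OF that] by (simp add: dist_c0_le_iff)
  have le_L: "k * dist x y powr \<alpha> \<le> L * dist x y powr \<alpha>" for x y :: 'a
    using k by (intro mult_right_mono) auto
  have g1: "c0_nth (f x) n - c0_nth (f y) n \<le> L * dist x y powr \<alpha>"
    and g2: "- c0_nth (f x) n - - c0_nth (f y) n \<le> L * dist x y powr \<alpha>"
    if "x \<in> M" "y \<in> M" for x y n
    using f_nth[OF that, of n] le_L[of x y] by (auto simp: abs_le_iff)
  define lo where "lo = (\<lambda>n x. mcshane \<alpha> L M (\<lambda>m. c0_nth (f m) n) x)"
  define hi where "hi = (\<lambda>n x. - mcshane \<alpha> L M (\<lambda>m. - c0_nth (f m) n) x)"
  define h where "h = (\<lambda>x n. max (lo n x) (min (hi n x) 0))"
  note mc1 = \<alpha> \<open>0 \<le> L\<close> \<open>M \<noteq> {}\<close> g1 and mc2 = \<alpha> \<open>0 \<le> L\<close> \<open>M \<noteq> {}\<close> g2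
  have lo_eq: "lo n x = c0_nth (f x) n" and hi_eq: "hi n x = c0_nth (f x) n" if "x \<in> M" for n x
    unfolding lo_def hi_def using mcshane_eq[OF mc1 that] mcshane_eq[OF mc2 that] by auto
  have lo_dist: "\<bar>lo n x - lo n y\<bar> \<le> L * dist x y powr \<alpha>"
    and hi_dist: "\<bar>hi n x - hi n y\<bar> \<le> L * dist x y powr \<alpha>" for n x y
    unfolding lo_def hi_def using mcshane_hoelder[OF mc1, of n x y] mcshane_hoelder[OF mc2, of n x y]
    by auto
  have null: "h x \<longlonglongrightarrow> 0" for x
  proof (rule LIMSEQ_I)
    fix e :: real
    assume "0 < e"
    have "\<forall>\<^sub>F n in sequentially. lo n x \<le> e / 2"
      unfolding lo_def
    proof (rule eventually_mono)
      show "\<forall>\<^sub>F n in sequentially. \<forall>m\<in>M. c0_nth (f m) n - L * dist x m powr \<alpha> \<le> e / 2"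
        using \<alpha> k kottman c0_nth_tendsto f_nth \<open>0 < e\<close>
        by (intro eventually_mcshane_bound) (auto simp: abs_le_iff)
    qed (rule mcshane_least[OF mc1], blast+)
    moreover have "\<forall>\<^sub>F n in sequentially. - (e / 2) \<le> hi n x"
    proof (rule eventually_mono)
      have "(\<lambda>n. - c0_nth (f m) n) \<longlonglongrightarrow> 0" for m
        using tendsto_minus[OF c0_nth_tendsto[of "f m"]] by simp
      with f_nth
      show "\<forall>\<^sub>F n in sequentially. \<forall>m\<in>M. - c0_nth (f m) n - L * dist x m powr \<alpha> \<le> e / 2"
        using \<alpha> k kottman \<open>0 < e\<close>
        by (intro eventually_mcshane_bound[where f = "\<lambda>m n. - c0_nth (f m) n"])
          (auto simp: abs_le_iff algebra_simps)
      fix n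
      assume "\<forall>m\<in>M. - c0_nth (f m) n - L * dist x m powr \<alpha> \<le> e / 2"
      then have "mcshane \<alpha> L M (\<lambda>m. - c0_nth (f m) n) x \<le> e / 2"
        by (intro mcshane_least[OF mc2]) auto
      then show "- (e / 2) \<le> hi n x"
        by (simp add: hi_def)
    qed
    ultimately have "\<forall>\<^sub>F n in sequentially. norm (h x n - 0) < e"
      by eventually_elim (use \<open>0 < e\<close> in \<open>auto simp: h_def max_def min_def\<close>)
    then show "\<exists>N. \<forall>n\<ge>N. norm (h x n - 0) < e"
      by (simp add: eventually_sequentially)
  qed
  then have nth: "c0_nth (Abs_c0 (h x)) n = h x n" for x n
    by (simp add: Abs_c0_inverse)
  show thesis
  proof (rule that[of "\<lambda>x. Abs_c0 (h x)"])
    show "Abs_c0 (h x) = f x" if "x \<in> M" for x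
      using that by (intro c0_eqI, unfold nth) (simp add: h_def lo_eq hi_eq)
    show "dist (Abs_c0 (h x)) (Abs_c0 (h y)) \<le> L * dist x y powr \<alpha>" for x y
      unfolding dist_c0_le_iff nth
    proof
      fix n
      show "\<bar>h x n - h y n\<bar> \<le> L * dist x y powr \<alpha>"
        unfolding h_def by (intro abs_clamp_diff_le lo_dist hi_dist)
    qed
  qed
qed

lemma extension_const_le:
  assumes "infinite_dimensional TYPE('a::banach)" and \<alpha>: "0 < \<alpha>" "\<alpha> \<le> 1"
    and l: "kottman TYPE('a) powr \<alpha> < l"
  shows "extension_const \<alpha> TYPE('a) TYPE(c0) \<le> ennreal l"
  unfolding extension_const_def
proof (rule Inf_lower, intro CollectI exI[of _ l] conjI allI impI)
  have "1 \<le> kottman TYPE('a) powr \<alpha>"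
    using one_le_kottman[OF assms(1)] \<alpha> by (simp add: ge_one_powr_ge_zero)
  with l have "1 < l"
    by linarith
  then show "0 < l"
    by simp
  fix M :: "'a set" and f :: "'a \<Rightarrow> c0"
  assume "hoelder_on \<alpha> M f"
  then obtain k where k: "0 \<le> k" "hoelder_const \<alpha> M f = ennreal k"
    unfolding hoelder_on_def by (cases "hoelder_const \<alpha> M f") auto
  then have f: "dist (f x) (f y) \<le> k * dist x y powr \<alpha>" if "x \<in> M" "y \<in> M" for x y
    using that hoelder_const_le_iff[of k \<alpha> M f] by auto
  obtain F where F: "\<And>x. x \<in> M \<Longrightarrow> F x = f x"
    "\<And>x y. dist (F x) (F y) \<le> l * k * dist x y powr \<alpha>"
    \<comment> \<open>A map with constant \<open>0\<close> has to be extended with constant \<open>0\<close>, which leaves no room for the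
      strict inequality \<open>k < l * k\<close>.\<close>
  proof (cases "M = {} \<or> k = 0")
    case True
    then have "f x = f (SOME m. m \<in> M)" if "x \<in> M" for x
      using that f[OF that someI[of "\<lambda>m. m \<in> M", OF that]] by auto
    then show thesis
      using \<open>0 < l\<close> k by (intro that[of "\<lambda>_. f (SOME m. m \<in> M)"]) auto
  next
    case False
    then show thesis
      using k l f \<open>1 < l\<close> \<alpha> c0_hoelder_extension[of \<alpha> k "l * k" M f] that by auto
  qed
  have "hoelder_const \<alpha> UNIV F \<le> ennreal (l * k)"
    using F(2) \<open>0 < l\<close> k by (subst hoelder_const_le_iff) auto
  also have "\<dots> = ennreal l * hoelder_const \<alpha> M f"
    using k \<open>0 < l\<close> by (simp add: ennreal_mult)
  finally show "\<exists>F. (\<forall>x\<in>M. F x = f x) \<and>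
      hoelder_const \<alpha> UNIV F \<le> ennreal l * hoelder_const \<alpha> M f"
    using F(1) by blast
qed (fact refl)

section \<open>The lower bound\<close>

lift_definition c0_unit :: "nat \<Rightarrow> c0" is "\<lambda>k n. if n = k then 1 else 0"
proof -
  fix k :: nat
  have "\<forall>\<^sub>F n in sequentially. (if n = k then 1 else 0 :: real) = 0"
    using eventually_gt_at_top[of k] by eventually_elim auto
  then show "(\<lambda>n. if n = k then 1 else 0 :: real) \<longlonglongrightarrow> 0"
    by (rule tendsto_eventually)
qed

lemma dist_c0_unit_le: "dist (c0_unit i) (c0_unit j) \<le> 1"
  by (simp add: dist_c0_le_iff c0_unit.rep_eq)

lemma one_le_bound_of_c0_unit:
  assumes "\<And>n. dist (c0_unit n) x \<le> K"
  shows "1 \<le> K"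
proof (rule LIMSEQ_le_const2)
  show "(\<lambda>n. \<bar>1 - c0_nth x n\<bar>) \<longlonglongrightarrow> 1"
    using c0_nth_tendsto[of x] by (auto intro!: tendsto_eq_intros)
  have "\<bar>1 - c0_nth x n\<bar> \<le> K" for n
    using assms[of n] by (auto simp: dist_c0_le_iff c0_unit.rep_eq dest: spec[of _ n])
  then show "\<exists>N. \<forall>n\<ge>N. \<bar>1 - c0_nth x n\<bar> \<le> K"
    by blast
qed

text \<open>The map sending \<open>x n\<close> to the \<open>n\<close>-th unit vector has constant at most \<open>sep x powr -\<alpha>\<close>,
  while every extension of it to the centre of the ball has constant at least \<open>1\<close>.\<close>

lemma sep_powr_le_extension_bound:
  fixes x :: "nat \<Rightarrow> 'a::real_normed_vector"
  assumes x: "range x \<subseteq> cball 0 1" and "0 < \<alpha>" "0 < l"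
    and ext: "\<And>(M :: 'a set) (f :: 'a \<Rightarrow> c0). hoelder_on \<alpha> M f \<Longrightarrow>
      \<exists>F. (\<forall>x\<in>M. F x = f x) \<and> hoelder_const \<alpha> UNIV F \<le> ennreal l * hoelder_const \<alpha> M f"
  shows "sep x powr \<alpha> \<le> l"
proof (cases "sep x = 0")
  case False
  then have pos: "0 < sep x"
    using sep_nonneg[of x] by simp
  then have "inj x"
    using sep_le[of _ _ x] by (intro injI) (metis diff_self norm_zero not_less)
  define f where "f = (\<lambda>y. c0_unit (inv x y))"
  have f: "f (x n) = c0_unit n" for n
    using \<open>inj x\<close> by (simp add: f_def)
  define k where "k = inverse (sep x powr \<alpha>)"
  have "0 < k"
    using pos by (simp add: k_def)
  have "dist (f (x i)) (f (x j)) \<le> k * dist (x i) (x j) powr \<alpha>" for i j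
  proof (cases "i = j")
    case False
    have "sep x powr \<alpha> \<le> dist (x i) (x j) powr \<alpha>"
      using sep_le[OF False, of x] \<open>0 < \<alpha>\<close> pos by (intro powr_mono2) (auto simp: dist_norm)
    then have "1 \<le> k * dist (x i) (x j) powr \<alpha>"
      using pos by (simp add: k_def field_simps)
    with dist_c0_unit_le[of i j] show ?thesis
      unfolding f by linarith
  qed simp
  then have hc: "hoelder_const \<alpha> (range x) f \<le> ennreal k"
    using \<open>0 < k\<close> by (subst hoelder_const_le_iff) auto
  then have "hoelder_on \<alpha> (range x) f"
    unfolding hoelder_on_def by (simp add: le_less_trans)
  from ext[OF this] obtain F where F: "\<And>n. F (x n) = f (x n)"
    "hoelder_const \<alpha> UNIV F \<le> ennreal l * hoelder_const \<alpha> (range x) f"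
    by blast
  have "hoelder_const \<alpha> UNIV F \<le> ennreal l * ennreal k"
    using F(2) mult_left_mono[OF hc, of "ennreal l"] by (auto intro: order_trans)
  also have "\<dots> = ennreal (l * k)"
    using \<open>0 < l\<close> \<open>0 < k\<close> by (simp add: ennreal_mult)
  finally have F_dist: "dist (F y) (F z) \<le> l * k * dist y z powr \<alpha>" for y z
    using \<open>0 < l\<close> \<open>0 < k\<close> by (subst (asm) hoelder_const_le_iff) auto
  have "1 \<le> l * k"
  proof (rule one_le_bound_of_c0_unit)
    fix n
    have "norm (x n) powr \<alpha> \<le> 1"
      using x \<open>0 < \<alpha>\<close> by (intro powr_le1) (auto simp: image_subset_iff)
    then have "l * k * norm (x n) powr \<alpha> \<le> l * k"
      using \<open>0 < l\<close> \<open>0 < k\<close> by (intro mult_left_le) auto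
    with F_dist[of "x n" 0] show "dist (c0_unit n) (F 0) \<le> l * k"
      by (simp add: F f)
  qed
  then show ?thesis
    using pos by (simp add: k_def field_simps)
qed (use assms in simp)

lemma le_extension_const:
  assumes "0 < \<alpha>"
  shows "ennreal (kottman TYPE('a::real_normed_vector) powr \<alpha>) \<le> extension_const \<alpha> TYPE('a) TYPE(c0)"
  unfolding extension_const_def
proof (rule Inf_greatest, elim CollectE exE conjE)
  fix e l
  assume e: "e = ennreal l" and "0 < l"
    and ext: "\<forall>(M :: 'a set) (f :: 'a \<Rightarrow> c0). hoelder_on \<alpha> M f \<longrightarrow>
      (\<exists>F. (\<forall>x\<in>M. F x = f x) \<and> hoelder_const \<alpha> UNIV F \<le> ennreal l * hoelder_const \<alpha> M f)"
  have sep_bound: "sep x \<le> l powr (1 / \<alpha>)" if "range x \<subseteq> cball 0 1" for x :: "nat \<Rightarrow> 'a"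
  proof -
    have "sep x powr \<alpha> \<le> l"
      using ext by (intro sep_powr_le_extension_bound that assms \<open>0 < l\<close>) auto
    then have "(sep x powr \<alpha>) powr (1 / \<alpha>) \<le> l powr (1 / \<alpha>)"
      using assms by (intro powr_mono2) auto
    then show ?thesis
      using assms sep_nonneg[of x] by (simp add: powr_powr)
  qed
  have ne: "range (\<lambda>_ :: nat. 0 :: 'a) \<subseteq> cball 0 1"
    by auto
  then have "0 \<le> kottman TYPE('a)"
    using sep_le_kottman sep_nonneg order_trans by blast
  moreover have "kottman TYPE('a) \<le> l powr (1 / \<alpha>)"
    unfolding kottman_def
  proof (rule cSUP_least)
    show "{x :: nat \<Rightarrow> 'a. range x \<subseteq> cball 0 1} \<noteq> {}"
      using ne by blast
  qed (use sep_bound in simp)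
  ultimately have "kottman TYPE('a) powr \<alpha> \<le> (l powr (1 / \<alpha>)) powr \<alpha>"
    using assms by (intro powr_mono2) auto
  then show "ennreal (kottman TYPE('a) powr \<alpha>) \<le> e"
    using assms \<open>0 < l\<close> by (simp add: e powr_powr ennreal_leI)
qed

theorem proposition2:
  fixes \<alpha> :: real
  assumes "infinite_dimensional TYPE('a::banach)"
    and "0 < \<alpha>" and "\<alpha> \<le> 1"
  shows "extension_const \<alpha> TYPE('a) TYPE(c0) = ennreal (kottman TYPE('a) powr \<alpha>)"
proof (rule antisym)
  show "extension_const \<alpha> TYPE('a) TYPE(c0) \<le> ennreal (kottman TYPE('a) powr \<alpha>)"
  proof (rule ennreal_le_epsilon)
    fix e :: real
    assume "0 < e"
    then have "extension_const \<alpha> TYPE('a) TYPE(c0) \<le> ennreal (kottman TYPE('a) powr \<alpha> + e)"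
      by (intro extension_const_le assms) simp
    with \<open>0 < e\<close>
    show "extension_const \<alpha> TYPE('a) TYPE(c0) \<le> ennreal (kottman TYPE('a) powr \<alpha>) + ennreal e"
      by simp
  qed
  show "ennreal (kottman TYPE('a) powr \<alpha>) \<le> extension_const \<alpha> TYPE('a) TYPE(c0)"
    by (rule le_extension_const) fact
qed

end
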